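(* Let $k\ge2$. For every $\delta>0$ there is $n_0$ such that for every $n\ge n_0$ divisible by $k$, every red/blue-coloring of $E(K_n)$ contains a $K_k$-factor with at least $(\lambda_k-\delta)n$ edges of the same color.
   Context: A $K_k$-factor of $K_n$ ($k\mid n$) is a collection of $n/k$ vertex-disjoint copies of $K_k$ covering all vertices; its edges are the edges of these cliques. The bipartite construction with ratio $\rho\in[0,1]$ is the red/blue-coloring of $K_n$ obtained by partitioning $V(K_n)=X\cup Y$ with $|X|=\rho n$, coloring all edges touching $X$ with one color and all edges inside $Y$ with the other color. For $k\ge2$, $\lambda_k$ is the supremum of all $\lambda$ such that for every $n$ divisible by $k$ and every $\rho\in[0,1]$ (with $\rho n$ an integer), the $n$-vertex bipartite construction with ratio $\rho$ has a $K_k$-factor with at least $\lambda n$ edges of the same color. *)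

theory Defs
  imports Complex_Main
begin

text \<open>Vertices of K_n are {0..<n}; edges are 2-element subsets. A red/blue colouring
  of E(K_n) is a function c :: nat set \<Rightarrow> bool (True = red, False = blue), of which
  only the values on edges {u,v} with u \<noteq> v, u,v < n matter.\<close>

definition is_Kk_factor :: "nat \<Rightarrow> nat \<Rightarrow> nat set set \<Rightarrow> bool" where
  "is_Kk_factor k n F \<longleftrightarrow>
     (\<forall>B\<in>F. B \<subseteq> {0..<n} \<and> card B = k) \<and>
     (\<forall>B\<in>F. \<forall>B'\<in>F. B \<noteq> B' \<longrightarrow> B \<inter> B' = {}) \<and>
     \<Union>F = {0..<n}"

definition factor_edges_col :: "(nat set \<Rightarrow> bool) \<Rightarrow> nat set set \<Rightarrow> bool \<Rightarrow> nat" where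
  "factor_edges_col c F b =
     card {e. \<exists>B\<in>F. \<exists>u\<in>B. \<exists>v\<in>B. u \<noteq> v \<and> e = {u, v} \<and> c e = b}"

text \<open>Bipartite construction on {0..<n} with X = {0..<m} (so rho = m/n):
  edges touching X get colour True, edges inside Y = {m..<n} get colour False.\<close>
definition bip_col :: "nat \<Rightarrow> nat set \<Rightarrow> bool" where
  "bip_col m e \<longleftrightarrow> e \<inter> {0..<m} \<noteq> {}"

definition lambda_k :: "nat \<Rightarrow> real" where
  "lambda_k k = Sup {lam :: real. \<forall>n m. k dvd n \<longrightarrow> m \<le> n \<longrightarrow>
      (\<exists>F. is_Kk_factor k n F \<and>
           (\<exists>b. real (factor_edges_col (bip_col m) F b) \<ge> lam * real n))}"

end

(* Call a vertex set balanced if it has a K_k-factor that is almost lambda_k-good in red and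
   another one that is almost lambda_k-good in blue. As m grows from 0 to n, the colour in which
   the bipartite construction is good switches from blue to red, and moving one vertex changes
   at most k edges of a factor, so some bipartite construction of fixed size is balanced.

   Remove disjoint balanced sets from the given coloring as long as possible; they cost nothing
   whichever colour is chosen at the end. If none is left, then a large red clique and a disjoint
   large blue clique cannot coexist: by bipartite Ramsey, large parts of them would have all their
   cross edges of one colour and so contain a copy of the balanced bipartite construction, perhaps
   with colours swapped. Hence, after deleting at most one clique of bounded size, one colour has
   no large clique, and by Ramsey all but boundedly many vertices are tiled by k-cliques of the
   other colour. *)
theory Submission
  imports Defs "HOL-Library.Ramsey"
begin

section \<open>Factors on arbitrary vertex sets\<close>

text \<open>Allowing any vertex set \<open>V\<close> makes it possible to split \<open>V\<close>,
  build factors on the pieces and glue them.\<close>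

definition factor_on :: "nat \<Rightarrow> 'a set \<Rightarrow> 'a set set \<Rightarrow> bool" where
  "factor_on k V F \<longleftrightarrow>
     (\<forall>B\<in>F. B \<subseteq> V \<and> card B = k) \<and>
     (\<forall>B\<in>F. \<forall>B'\<in>F. B \<noteq> B' \<longrightarrow> B \<inter> B' = {}) \<and> \<Union>F = V"

lemma is_Kk_factor_iff: "is_Kk_factor k n F \<longleftrightarrow> factor_on k {0..<n} F"
  by (simp add: is_Kk_factor_def factor_on_def)

definition col_edges :: "('a set \<Rightarrow> bool) \<Rightarrow> 'a set set \<Rightarrow> bool \<Rightarrow> 'a set set" where
  "col_edges c F b = {e. \<exists>B\<in>F. \<exists>u\<in>B. \<exists>v\<in>B. u \<noteq> v \<and> e = {u, v} \<and> c e = b}"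

lemma factor_edges_col_eq: "factor_edges_col c F b = card (col_edges c F b)"
  by (simp add: factor_edges_col_def col_edges_def)

text \<open>The colour \<open>b\<close> is fixed so that counts on disjoint pieces can be added. The
  target \<open>s\<close> is a real that may be negative, so bounds with an additive error become
  trivial on small sets.\<close>

definition has_factor :: "nat \<Rightarrow> ('a set \<Rightarrow> bool) \<Rightarrow> bool \<Rightarrow> 'a set \<Rightarrow> real \<Rightarrow> bool" where
  "has_factor k c b V s \<longleftrightarrow> (\<exists>F. factor_on k V F \<and> s \<le> real (card (col_edges c F b)))"

lemma has_factor_mono: "has_factor k c b V s \<Longrightarrow> t \<le> s \<Longrightarrow> has_factor k c b V t"
  unfolding has_factor_def by (meson order_trans)

lemma col_edges_subset:
  assumes "factor_on k V F"
  shows "col_edges c F b \<subseteq> Pow V"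
  using assms unfolding factor_on_def col_edges_def by blast

lemma finite_col_edges:
  assumes "factor_on k V F" "finite V"
  shows "finite (col_edges c F b)"
  using col_edges_subset[OF assms(1)] assms(2) by (meson finite_Pow_iff finite_subset)

lemma has_factor_Un:
  assumes V: "has_factor k c b V s" and W: "has_factor k c b W t"
    and fin: "finite V" "finite W" and disj: "V \<inter> W = {}"
  shows "has_factor k c b (V \<union> W) (s + t)"
proof -
  obtain F where F: "factor_on k V F" "s \<le> real (card (col_edges c F b))"
    using V unfolding has_factor_def by blast
  obtain G where G: "factor_on k W G" "t \<le> real (card (col_edges c G b))"
    using W unfolding has_factor_def by blast
  have fac: "factor_on k (V \<union> W) (F \<union> G)"
    unfolding factor_on_def
  proof (intro conjI ballI impI)
    fix B B' assume B: "B \<in> F \<union> G" "B' \<in> F \<union> G" "B \<noteq> B'"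
    show "B \<inter> B' = {}"
      using B F(1) G(1) disj unfolding factor_on_def by (metis UnE inf_mono inf_commute subset_empty)
  qed (use F(1) G(1) in \<open>auto simp: factor_on_def\<close>)
  have eq: "col_edges c (F \<union> G) b = col_edges c F b \<union> col_edges c G b"
    unfolding col_edges_def by blast
  \<comment> \<open>Common edges would lie in \<open>V \<inter> W\<close>, so only the empty set
    could be shared, and it is not an edge.\<close>
  have "{} \<notin> col_edges c F b"
    unfolding col_edges_def by blast
  moreover have "e = {}" if "e \<in> col_edges c F b \<inter> col_edges c G b" for e
    using that col_edges_subset[OF F(1), of c b] col_edges_subset[OF G(1), of c b] disj by blast
  ultimately have "col_edges c F b \<inter> col_edges c G b = {}"
    by blast
  then have "card (col_edges c (F \<union> G) b) = card (col_edges c F b) + card (col_edges c G b)"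
    unfolding eq using finite_col_edges[OF F(1)] finite_col_edges[OF G(1)] fin
    by (intro card_Un_disjoint) auto
  then show ?thesis
    unfolding has_factor_def using F(2) G(2) fac by (intro exI[of _ "F \<union> G"]) auto
qed

text \<open>The bijection maps factors to factors and the counted edges injectively to counted
  edges. Letting \<open>b'\<close> differ from \<open>b\<close> covers copies with the two colours
  swapped.\<close>

lemma has_factor_transfer:
  assumes h: "has_factor k c b V s" and f: "bij_betw f V W" and fin: "finite V"
    and col: "\<And>u v. u \<in> V \<Longrightarrow> v \<in> V \<Longrightarrow> u \<noteq> v \<Longrightarrow> c' {f u, f v} = b' \<longleftrightarrow> c {u, v} = b"
  shows "has_factor k c' b' W s"
proof -
  obtain F where F: "factor_on k V F" "s \<le> real (card (col_edges c F b))"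
    using h unfolding has_factor_def by blast
  have inj: "inj_on f V" and W: "W = f ` V"
    using f by (auto simp: bij_betw_def)
  have sub: "B \<subseteq> V" "card B = k" if "B \<in> F" for B
    using F(1) that unfolding factor_on_def by auto
  have fac: "factor_on k W ((`) f ` F)"
    unfolding factor_on_def
  proof (intro conjI ballI impI)
    fix B assume "B \<in> (`) f ` F"
    then show "B \<subseteq> W" "card B = k"
      using sub inj W by (auto simp: card_image inj_on_subset)
  next
    fix B B' assume "B \<in> (`) f ` F" "B' \<in> (`) f ` F" "B \<noteq> B'"
    then obtain D D' where D: "D \<in> F" "D' \<in> F" "B = f ` D" "B' = f ` D'" "D \<noteq> D'" by auto
    then have "D \<inter> D' = {}" using F(1) unfolding factor_on_def by blast
    then show "B \<inter> B' = {}"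
      using inj_on_image_Int[OF inj, of D D'] sub D by auto
  next
    show "\<Union> ((`) f ` F) = W"
      using F(1) W unfolding factor_on_def by blast
  qed
  have "(`) f ` col_edges c F b \<subseteq> col_edges c' ((`) f ` F) b'"
  proof
    fix e' assume "e' \<in> (`) f ` col_edges c F b"
    then obtain B u v where B: "B \<in> F" "u \<in> B" "v \<in> B" "u \<noteq> v" "c {u, v} = b" "e' = {f u, f v}"
      unfolding col_edges_def by auto
    then have V: "u \<in> V" "v \<in> V" using sub by auto
    then have "f u \<noteq> f v" "c' {f u, f v} = b'"
      using B inj col by (auto dest: inj_onD)
    then show "e' \<in> col_edges c' ((`) f ` F) b'"
      unfolding col_edges_def using B by blast
  qed
  moreover have "finite (col_edges c' ((`) f ` F) b')"
    using finite_col_edges[OF fac] fin W by simp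
  moreover have "inj_on ((`) f) (col_edges c F b)"
    using inj_on_subset[OF inj_on_image_Pow[OF inj] col_edges_subset[OF F(1)]] .
  ultimately have "card (col_edges c F b) \<le> card (col_edges c' ((`) f ` F) b')"
    by (metis card_image card_mono)
  then show ?thesis
    unfolding has_factor_def using F(2) fac by force
qed

text \<open>Splitting off arbitrary \<open>k\<close>-sets gives a factor. This settles every case
  with a nonpositive target.\<close>

lemma has_factor_trivial:
  assumes "finite V" "k > 0" "k dvd card V"
  shows "has_factor k c b V 0"
  using assms
proof (induction "card V" arbitrary: V rule: less_induct)
  case less
  show ?case
  proof (cases "V = {}")
    case True
    then show ?thesis
      unfolding has_factor_def factor_on_def by (intro exI[of _ "{}"]) auto
  next
    case False
    then have le: "k \<le> card V"
      using less.prems by (simp add: dvd_imp_le card_gt_0_iff)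
    then obtain K where K: "K \<subseteq> V" "card K = k"
      using obtain_subset_with_card_n by metis
    have fin: "finite K" "finite (V - K)"
      using K less.prems finite_subset by auto
    have card: "card (V - K) = card V - k"
      using K fin by (simp add: card_Diff_subset)
    have "has_factor k c b K 0"
      unfolding has_factor_def factor_on_def using K by (intro exI[of _ "{K}"]) auto
    moreover have "has_factor k c b (V - K) 0"
      using less.prems le card fin by (intro less.hyps) auto
    ultimately have "has_factor k c b (K \<union> (V - K)) (0 + 0)"
      using fin by (intro has_factor_Un) auto
    then show ?thesis
      using K by (simp add: Un_absorb1)
  qed
qed

section \<open>Monochromatic cliques and Ramsey arguments\<close>

definition mono_clique :: "('a set \<Rightarrow> bool) \<Rightarrow> bool \<Rightarrow> 'a set \<Rightarrow> bool" where
  "mono_clique c b A \<longleftrightarrow> (\<forall>u\<in>A. \<forall>v\<in>A. u \<noteq> v \<longrightarrow> c {u, v} = b)"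

lemma mono_clique_subset: "mono_clique c b A \<Longrightarrow> A' \<subseteq> A \<Longrightarrow> mono_clique c b A'"
  unfolding mono_clique_def by blast

lemma ramsey_mono_clique:
  "\<exists>r. \<forall>(c :: 'a set \<Rightarrow> bool) b V. finite V \<longrightarrow> r \<le> card V \<longrightarrow>
     (\<exists>R\<subseteq>V. card R = m \<and> mono_clique c b R \<or> card R = n \<and> mono_clique c (\<not> b) R)"
proof -
  obtain r where r: "\<And>(V::'a set) E. finite V \<Longrightarrow> r \<le> card V \<Longrightarrow>
      \<exists>R \<subseteq> V. card R = m \<and> clique R E \<or> card R = n \<and> indep R E"
    using ramsey2[of m n] by blast
  show ?thesis
  proof (intro exI[of _ r] allI impI)
    fix c :: "'a set \<Rightarrow> bool" and b and V :: "'a set"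
    assume "finite V" "r \<le> card V"
    then obtain R where "R \<subseteq> V"
      "card R = m \<and> clique R {e. c e = b} \<or> card R = n \<and> indep R {e. c e = b}"
      using r by blast
    then show "\<exists>R\<subseteq>V. card R = m \<and> mono_clique c b R \<or> card R = n \<and> mono_clique c (\<not> b) R"
      unfolding clique_def indep_def mono_clique_def by (intro exI[of _ R]) auto
  qed
qed

text \<open>Restrict to \<open>2 * n\<close> vertices of \<open>B\<close>. They leave only
  \<open>2 ^ (2 * n)\<close> possible neighbourhoods, so by pigeonhole \<open>n\<close> vertices of
  \<open>A\<close> share one of them, \<open>S\<close>; then \<open>S\<close> or its complement has
  at least \<open>n\<close> elements.\<close>

lemma bipartite_ramsey:
  fixes P :: "'a \<Rightarrow> 'b \<Rightarrow> bool"
  assumes "finite A" "finite B" and A: "n * 2 ^ (2 * n) < card A" and B: "2 * n \<le> card B"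
  obtains A' B' b where "A' \<subseteq> A" "B' \<subseteq> B" "card A' = n" "card B' = n"
    "\<And>u v. u \<in> A' \<Longrightarrow> v \<in> B' \<Longrightarrow> P u v = b"
proof -
  obtain B0 where B0: "B0 \<subseteq> B" "card B0 = 2 * n" "finite B0"
    using obtain_subset_with_card_n[OF B] by metis
  define \<phi> where "\<phi> u = {v \<in> B0. P u v}" for u
  have "\<exists>S\<in>Pow B0. n \<le> card {u \<in> A. \<phi> u = S}"
  proof (rule ccontr)
    assume none: "\<not> ?thesis"
    have *: "card {u \<in> A. \<phi> u = S} \<le> n" if "S \<in> Pow B0" for S
    proof -
      have "\<not> n \<le> card {u \<in> A. \<phi> u = S}"
        using none that by blast
      then show ?thesis by simp
    qed
    have "\<phi> u \<in> Pow B0" for u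
      unfolding \<phi>_def by blast
    then have "A \<subseteq> (\<Union>S\<in>Pow B0. {u \<in> A. \<phi> u = S})"
      by blast
    then have "card A \<le> card (\<Union>S\<in>Pow B0. {u \<in> A. \<phi> u = S})"
      using B0 assms(1) by (intro card_mono) auto
    also have "\<dots> \<le> (\<Sum>S\<in>Pow B0. card {u \<in> A. \<phi> u = S})"
      using B0 by (intro card_UN_le) auto
    also have "\<dots> \<le> of_nat (card (Pow B0)) * n"
      by (intro sum_bounded_above *)
    finally show False
      using A B0 by (simp add: card_Pow mult.commute)
  qed
  then obtain S where S: "S \<subseteq> B0" "n \<le> card {u \<in> A. \<phi> u = S}" by auto
  then obtain A' where A': "A' \<subseteq> {u \<in> A. \<phi> u = S}" "card A' = n"
    using obtain_subset_with_card_n by metis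
  have "card S + card (B0 - S) = 2 * n"
    using S(1) B0(2,3) card_Un_disjoint[of S "B0 - S"] finite_subset[OF S(1)]
    by (simp add: Un_absorb1)
  then have "n \<le> card S \<or> n \<le> card (B0 - S)" by linarith
  then obtain B' b where B': "card B' = n" "B' \<subseteq> (if b then S else B0 - S)"
  proof (elim disjE)
    assume "n \<le> card S"
    then show thesis
      using obtain_subset_with_card_n[of n S] that[of _ True] by auto
  next
    assume "n \<le> card (B0 - S)"
    then show thesis
      using obtain_subset_with_card_n[of n "B0 - S"] that[of _ False] by auto
  qed
  have "P u v = b" if "u \<in> A'" "v \<in> B'" for u v
    using that A' B' S unfolding \<phi>_def by (auto split: if_splits)
  moreover have "A' \<subseteq> A" "B' \<subseteq> B"
    using A' B' S B0 by (auto split: if_splits)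
  ultimately show ?thesis
    using A' B' that by blast
qed

section \<open>The bipartite construction and its crossing point\<close>

text \<open>Only edges at the vertex \<open>m\<close> change colour, and those in the factor lie in
  the one clique containing \<open>m\<close>.\<close>

lemma card_col_edges_bip_Suc:
  assumes F: "factor_on k {0..<n} F"
  shows "card (col_edges (bip_col (Suc m)) F True) \<le> card (col_edges (bip_col m) F True) + k"
proof -
  obtain B where B: "finite B" "card B \<le> k" "\<And>D. D \<in> F \<Longrightarrow> m \<in> D \<Longrightarrow> D = B"
  proof (cases "\<exists>D\<in>F. m \<in> D")
    case True
    then obtain D where D: "D \<in> F" "m \<in> D" by blast
    have "D \<subseteq> {0..<n}" "card D = k" "\<And>D'. D' \<in> F \<Longrightarrow> m \<in> D' \<Longrightarrow> D' = D"
      using F D unfolding factor_on_def by (simp, simp, metis IntI empty_iff)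
    then show ?thesis
      using finite_subset by (intro that[of D]) auto
  next
    case False
    then show ?thesis by (intro that[of "{}"]) auto
  qed
  \<comment> \<open>The image may include the degenerate set \<open>{m}\<close>; this costs one in
    the count and keeps the bound at \<open>k\<close>.\<close>
  have "col_edges (bip_col (Suc m)) F True \<subseteq>
      col_edges (bip_col m) F True \<union> (\<lambda>v. {m, v}) ` B"
  proof
    fix e assume "e \<in> col_edges (bip_col (Suc m)) F True"
    then obtain D u v where e: "D \<in> F" "u \<in> D" "v \<in> D" "u \<noteq> v" "e = {u, v}"
      and col: "bip_col (Suc m) e"
      unfolding col_edges_def by blast
    from col have "u \<le> m \<or> v \<le> m"
      unfolding bip_col_def e(5) by auto
    show "e \<in> col_edges (bip_col m) F True \<union> (\<lambda>v. {m, v}) ` B"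
    proof (cases "u < m \<or> v < m")
      case True
      then have "bip_col m e"
        unfolding bip_col_def e(5) by auto
      then show ?thesis
        unfolding col_edges_def using e by blast
    next
      case False
      then have "u = m \<or> v = m" using \<open>u \<le> m \<or> v \<le> m\<close> by auto
      then have "e \<in> (\<lambda>v. {m, v}) ` B"
        using e(1-3,5) B(3)[of D] by (elim disjE) (auto simp: insert_commute)
      then show ?thesis ..
    qed
  qed
  then have "card (col_edges (bip_col (Suc m)) F True) \<le>
      card (col_edges (bip_col m) F True \<union> (\<lambda>v. {m, v}) ` B)"
    using finite_col_edges[OF F] B by (intro card_mono) auto
  also have "\<dots> \<le> card (col_edges (bip_col m) F True) + card ((\<lambda>v. {m, v}) ` B)"
    by (rule card_Un_le)
  also have "card ((\<lambda>v. {m, v}) ` B) \<le> k"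
    using card_image_le[OF B(1)] B(2) le_trans by blast
  finally show ?thesis by simp
qed

lemma col_edges_bip_0: "col_edges (bip_col 0) F True = {}"
  unfolding col_edges_def bip_col_def by auto

lemma col_edges_bip_full:
  assumes "factor_on k {0..<n} F"
  shows "col_edges (bip_col n) F False = {}"
  using assms unfolding col_edges_def bip_col_def factor_on_def by fastforce

text \<open>Membership in the set whose supremum is \<open>lambda_k\<close>. Arguing with one
  admissible \<open>lam\<close> avoids the question whether the supremum is attained.\<close>

definition bip_bound :: "nat \<Rightarrow> real \<Rightarrow> bool" where
  "bip_bound k lam \<longleftrightarrow> (\<forall>n m. k dvd n \<longrightarrow> m \<le> n \<longrightarrow>
     (\<exists>b. has_factor k (bip_col m) b {0..<n} (lam * real n)))"

lemma lambda_k_eq: "lambda_k k = Sup {lam. bip_bound k lam}"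
  unfolding lambda_k_def bip_bound_def has_factor_def is_Kk_factor_iff factor_edges_col_eq
  by (rule arg_cong[of _ _ Sup]) blast

text \<open>The last value of \<open>m\<close> for which the blue bound is met is a discrete crossing point: one
  step further the red bound is met, and a single step costs at most \<open>k\<close> red edges.\<close>
lemma bip_crossing:
  assumes lam: "bip_bound k lam" and k: "k > 0" "k dvd n"
  obtains m where "m \<le> n" "has_factor k (bip_col m) False {0..<n} (lam * n)"
    "has_factor k (bip_col m) True {0..<n} (lam * n - k)"
proof -
  let ?P = "\<lambda>m b. has_factor k (bip_col m) b {0..<n} (lam * n)"
  have or: "?P m False \<or> ?P m True" if "m \<le> n" for m
    using lam k that unfolding bip_bound_def by (metis (full_types))
  \<comment> \<open>Needed at both ends: for \<open>m = 0\<close> nothing is red, so a red bound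
    forces \<open>lam * n \<le> 0\<close>, and then any factor meets the blue bound. The end
    \<open>m = n\<close> is symmetric.\<close>
  have triv: "?P m b" if "lam * n \<le> 0" for m b
    using has_factor_mono[OF has_factor_trivial[of "{0..<n}"] that] k by simp
  have P0: "?P 0 False"
    using or[of 0] triv[of 0 False] by (auto simp: has_factor_def col_edges_bip_0)
  have Pn: "?P n True"
    using or[of n] triv[of n True] by (auto simp: has_factor_def col_edges_bip_full)
  define m where "m = Max {m. m \<le> n \<and> ?P m False}"
  have fin: "finite {m. m \<le> n \<and> ?P m False}" by simp
  have "m \<in> {m. m \<le> n \<and> ?P m False}"
    unfolding m_def using P0 by (intro Max_in[OF fin]) auto
  then have m: "m \<le> n" "?P m False" by auto
  have "has_factor k (bip_col m) True {0..<n} (lam * n - k)"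
  proof (cases "m = n")
    case True
    then show ?thesis using Pn has_factor_mono[OF Pn] by simp
  next
    case False
    then have "Suc m \<le> n" using m by simp
    moreover have "\<not> ?P (Suc m) False"
      using Max_ge[OF fin, of "Suc m"] \<open>Suc m \<le> n\<close> unfolding m_def[symmetric] by auto
    ultimately have "?P (Suc m) True" using or by blast
    then obtain F where F: "factor_on k {0..<n} F"
      "lam * n \<le> real (card (col_edges (bip_col (Suc m)) F True))"
      unfolding has_factor_def by blast
    then show ?thesis
      unfolding has_factor_def using card_col_edges_bip_Suc[OF F(1), of m]
      by (intro exI[of _ F]) auto
  qed
  with m that show ?thesis by blast
qed

section \<open>Tiling by monochromatic cliques\<close>

text \<open>The construction with \<open>n = k\<close> and \<open>m = 0\<close> is a single blue
  clique, so admissibility of \<open>lam\<close> already bounds \<open>lam * k\<close> by its number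
  of edges.\<close>

lemma mono_clique_has_factor:
  assumes lam: "bip_bound k lam" and K: "card K = k" "k > 0" "mono_clique c b K"
  shows "has_factor k c b K (lam * k)"
proof -
  obtain b0 where b0: "has_factor k (bip_col 0) b0 {0..<k} (lam * k)"
    using lam unfolding bip_bound_def by (metis dvd_refl le0)
  have fin: "finite K" using K card_ge_0_finite by blast
  show ?thesis
  proof (cases b0)
    case True
    then have "lam * k \<le> 0" using b0 by (auto simp: has_factor_def col_edges_bip_0)
    then show ?thesis
      using has_factor_mono[OF has_factor_trivial[OF fin]] K by simp
  next
    case False
    obtain f where f: "bij_betw f {0..<k} K"
      using ex_bij_betw_nat_finite[OF fin] K by auto
    have "bij_betw f {0..<k} K \<Longrightarrow> u < k \<Longrightarrow> f u \<in> K" for u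
      by (auto simp: bij_betw_def)
    moreover have "u < k \<Longrightarrow> v < k \<Longrightarrow> u \<noteq> v \<Longrightarrow> f u \<noteq> f v" for u v
      using f by (auto simp: bij_betw_def inj_on_def)
    ultimately show ?thesis
      using b0 False f K(3)
      by (intro has_factor_transfer[of k "bip_col 0" False "{0..<k}" "lam * k" f])
        (auto simp: mono_clique_def bip_col_def)
  qed
qed

text \<open>While at least \<open>r\<close> vertices remain, Ramsey yields a \<open>k\<close>-clique
  of colour \<open>b\<close> to split off, as the other outcome is excluded. The fewer than
  \<open>r\<close> vertices left are partitioned arbitrarily, at a loss of at most
  \<open>\<bar>lam\<bar> * r\<close>.\<close>

lemma mono_tiling:
  assumes lam: "bip_bound k lam" and k: "k > 0"
  shows "\<exists>C\<ge>0. \<forall>(c :: 'a set \<Rightarrow> bool) b W. finite W \<longrightarrow> k dvd card W \<longrightarrow>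
     (\<nexists>A. A \<subseteq> W \<and> card A = M \<and> mono_clique c (\<not> b) A) \<longrightarrow>
     has_factor k c b W (lam * card W - C)"
proof -
  obtain r where r: "\<And>(c :: 'a set \<Rightarrow> bool) b V. finite V \<Longrightarrow> r \<le> card V \<Longrightarrow>
     \<exists>R\<subseteq>V. card R = k \<and> mono_clique c b R \<or> card R = M \<and> mono_clique c (\<not> b) R"
    using ramsey_mono_clique[of k M] by blast
  have "has_factor k c b W (lam * card W - \<bar>lam\<bar> * r)"
    if "finite W" "k dvd card W" "\<nexists>A. A \<subseteq> W \<and> card A = M \<and> mono_clique c (\<not> b) A"
    for c :: "'a set \<Rightarrow> bool" and b W
    using that
  proof (induction "card W" arbitrary: W rule: less_induct)
    case less
    show ?case
    proof (cases "r \<le> card W")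
      case False
      then have "lam * card W \<le> \<bar>lam\<bar> * r"
        by (intro mult_mono) auto
      then show ?thesis
        using has_factor_mono[OF has_factor_trivial[OF less.prems(1) k less.prems(2)]] by simp
    next
      case True
      then obtain K where K: "K \<subseteq> W" "card K = k" "mono_clique c b K"
        using r[OF less.prems(1), of c b] less.prems(3) by blast
      have fin: "finite K" "finite (W - K)"
        using K less.prems finite_subset by auto
      have le: "k \<le> card W" using K less.prems(1) card_mono by blast
      have card: "card (W - K) = card W - k"
        using K fin by (simp add: card_Diff_subset)
      have "has_factor k c b (W - K) (lam * card (W - K) - \<bar>lam\<bar> * r)"
        using less.prems le card fin k by (intro less.hyps) auto
      from has_factor_Un[OF mono_clique_has_factor[OF lam K(2) k K(3)] this fin]
      have "has_factor k c b (K \<union> (W - K)) (lam * k + (lam * card (W - K) - \<bar>lam\<bar> * r))"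
        by auto
      then show ?thesis
        using K le by (simp add: card Un_absorb1 of_nat_diff algebra_simps)
    qed
  qed
  then show ?thesis by (intro exI[of _ "\<bar>lam\<bar> * r"]) auto
qed

section \<open>Balanced sets in a given coloring\<close>

text \<open>\<open>X \<union> Y\<close> is a copy of the construction, with colours swapped when
  \<open>b\<close> is blue. The colour \<open>d = b\<close> is what \<open>d\<close> becomes: itself
  for red \<open>b\<close>, the opposite for blue \<open>b\<close>.\<close>

lemma bip_copy:
  assumes X: "card X = m" "finite X" "mono_clique c b X"
    and Y: "card Y = n - m" "finite Y" "mono_clique c (\<not> b) Y"
    and XY: "X \<inter> Y = {}" "\<And>u v. u \<in> X \<Longrightarrow> v \<in> Y \<Longrightarrow> c {u, v} = b" and m: "m \<le> n"
    and bip: "has_factor k (bip_col m) d {0..<n} s"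
  shows "has_factor k c (d = b) (X \<union> Y) s"
proof -
  obtain f where f: "bij_betw f {0..<m} X"
    using ex_bij_betw_nat_finite[OF X(2)] X(1) by auto
  obtain g where g: "bij_betw g {m..<n} Y"
    using finite_same_card_bij[of "{m..<n}" Y] Y by auto
  define h where "h u = (if u < m then f u else g u)" for u
  have "bij_betw h {0..<m} X \<longleftrightarrow> bij_betw f {0..<m} X"
    "bij_betw h {m..<n} Y \<longleftrightarrow> bij_betw g {m..<n} Y"
    by (auto simp: h_def intro!: bij_betw_cong)
  with f g have "bij_betw h {0..<m} X" "bij_betw h {m..<n} Y" by auto
  then have "bij_betw h ({0..<m} \<union> {m..<n}) (X \<union> Y)"
    using XY(1) by (intro bij_betw_combine)
  then have bij: "bij_betw h {0..<n} (X \<union> Y)"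
    using m by (simp add: ivl_disj_un)
  have hX: "h u \<in> X" if "u < m" for u
    using that f by (auto simp: h_def bij_betw_def)
  have hY: "h u \<in> Y" if "\<not> u < m" "u < n" for u
    using that g by (auto simp: h_def bij_betw_def)
  have "c {h u, h v} = (d = b) \<longleftrightarrow> bip_col m {u, v} = d"
    if uv: "u \<in> {0..<n}" "v \<in> {0..<n}" "u \<noteq> v" for u v
  proof -
    have ne: "h u \<noteq> h v"
      using bij uv by (auto simp: bij_betw_def inj_on_def)
    have "c {h u, h v} = (if u < m \<or> v < m then b else \<not> b)"
    proof -
      consider "u < m" "v < m" | "u < m" "\<not> v < m" | "\<not> u < m" "v < m" | "\<not> u < m" "\<not> v < m"
        by blast
      then show ?thesis
      proof cases
        case 1
        then show ?thesis using hX[of u] hX[of v] X(3) ne unfolding mono_clique_def by auto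
      next
        case 2
        then show ?thesis using hX[of u] hY[of v] XY(2) uv by auto
      next
        case 3
        then show ?thesis using hX[of v] hY[of u] XY(2)[of "h v" "h u"] uv
          by (auto simp: insert_commute)
      next
        case 4
        then show ?thesis using hY[of u] hY[of v] Y(3) ne uv unfolding mono_clique_def by auto
      qed
    qed
    moreover have "bip_col m {u, v} \<longleftrightarrow> u < m \<or> v < m"
      unfolding bip_col_def by auto
    ultimately show ?thesis by auto
  qed
  then show ?thesis
    by (intro has_factor_transfer[OF bip bij]) auto
qed

lemma balanced_set:
  assumes m: "m \<le> n" and h: "\<And>b. has_factor k (bip_col m) b {0..<n} s"
    and R: "finite R" "n * 2 ^ (2 * n) < card R" "mono_clique c True R"
    and B: "finite B" "2 * n \<le> card B" "mono_clique c False B" and RB: "R \<inter> B = {}"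
  shows "\<exists>S\<subseteq>R \<union> B. card S = n \<and> (\<forall>b. has_factor k c b S s)"
proof -
  obtain R' B' b where RB': "R' \<subseteq> R" "B' \<subseteq> B" "card R' = n" "card B' = n"
    "\<And>u v. u \<in> R' \<Longrightarrow> v \<in> B' \<Longrightarrow> c {u, v} = b"
    by (rule bipartite_ramsey[OF R(1) B(1) R(2) B(2), of "\<lambda>u v. c {u, v}"]) (rule that)
  \<comment> \<open>Edges touching \<open>X\<close> must all have the colour \<open>b\<close> of the
    cross edges, so \<open>X\<close> has to come from the clique that itself has colour
    \<open>b\<close>.\<close>
  define P Q where "P = (if b then R' else B')" and "Q = (if b then B' else R')"
  have PQ: "card P = n" "card Q = n" "mono_clique c b P" "mono_clique c (\<not> b) Q"
    "P \<inter> Q = {}" "P \<union> Q \<subseteq> R \<union> B" "finite P" "finite Q"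
    "\<And>u v. u \<in> P \<Longrightarrow> v \<in> Q \<Longrightarrow> c {u, v} = b"
  proof -
    have R': "finite R'" "mono_clique c True R'" and B': "finite B'" "mono_clique c False B'"
      using finite_subset[OF RB'(1) R(1)] mono_clique_subset[OF R(3) RB'(1)]
        finite_subset[OF RB'(2) B(1)] mono_clique_subset[OF B(3) RB'(2)] by auto
    have "R' \<inter> B' = {}" "R' \<union> B' \<subseteq> R \<union> B" "B' \<union> R' \<subseteq> R \<union> B"
      using RB'(1,2) RB by blast+
    then show "card P = n" "card Q = n" "mono_clique c b P" "mono_clique c (\<not> b) Q"
      "P \<inter> Q = {}" "P \<union> Q \<subseteq> R \<union> B" "finite P" "finite Q"
      using RB'(3,4) R' B' by (simp_all add: P_def Q_def Int_commute)
    show "c {u, v} = b" if "u \<in> P" "v \<in> Q" for u v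
      using that RB'(5)[of u v] RB'(5)[of v u]
      by (cases b) (simp_all add: P_def Q_def insert_commute)
  qed
  obtain X where X: "X \<subseteq> P" "card X = m" "finite X"
    using obtain_subset_with_card_n[of m P] m PQ(1) by metis
  obtain Y where Y: "Y \<subseteq> Q" "card Y = n - m" "finite Y"
    using obtain_subset_with_card_n[of "n - m" Q] PQ(2) by (metis diff_le_self)
  have "has_factor k c (d = b) (X \<union> Y) s" for d
  proof (rule bip_copy[OF X(2,3) _ Y(2,3) _ _ _ m h])
    show "mono_clique c b X" "mono_clique c (\<not> b) Y"
      using PQ(3,4) X(1) Y(1) mono_clique_subset by blast+
    show "X \<inter> Y = {}" "\<And>u v. u \<in> X \<Longrightarrow> v \<in> Y \<Longrightarrow> c {u, v} = b"
      using PQ(5,9) X(1) Y(1) by blast+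
  qed
  \<comment> \<open>For fixed \<open>b\<close>, the colour \<open>d = b\<close> takes both values as
    \<open>d\<close> does, so a possible swap is harmless.\<close>
  from this[of "\<not> b"] this[of b] this[of True] this[of False]
  have "has_factor k c d (X \<union> Y) s" for d
    by (cases d; cases b) simp_all
  moreover have "card (X \<union> Y) = n"
    using X Y PQ(5) m by (subst card_Un_disjoint) auto
  ultimately show ?thesis
    using X Y PQ(6) by (intro exI[of _ "X \<union> Y"]) auto
qed

section \<open>The lower bound for every coloring\<close>

text \<open>The removal of balanced sets becomes a strong induction on \<open>card U\<close>; the
  constant is fixed before the coloring and \<open>U\<close>.\<close>

lemma factor_bound:
  assumes lam: "bip_bound k lam" and k: "k > 0" and \<epsilon>: "\<epsilon> > 0"
  shows "\<exists>C\<ge>0. \<forall>(c :: 'a set \<Rightarrow> bool) U. finite U \<longrightarrow> k dvd card U \<longrightarrow>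
     (\<exists>b. has_factor k c b U ((lam - \<epsilon>) * card U - C))"
proof -
  \<comment> \<open>With \<open>t \<ge> 1 / \<epsilon>\<close>, the \<open>k\<close> red edges lost
    at the crossing point are at most \<open>\<epsilon> * n\<close>.\<close>
  define t where "t = nat \<lceil>1 / \<epsilon>\<rceil> + 1"
  define n where "n = k * t"
  have n: "k dvd n" "n > 0" using k by (auto simp: n_def t_def)
  have "1 / \<epsilon> \<le> real t" unfolding t_def by linarith
  then have "1 \<le> \<epsilon> * t" using \<epsilon> by (simp add: field_simps)
  then have "real k * 1 \<le> real k * (\<epsilon> * t)" using k by (intro mult_left_mono) auto
  then have kn: "k \<le> \<epsilon> * n" by (simp add: n_def algebra_simps)
  obtain m where m: "m \<le> n" "has_factor k (bip_col m) False {0..<n} (lam * n)"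
    "has_factor k (bip_col m) True {0..<n} (lam * n - k)"
    using bip_crossing[OF lam k n(1)] .
  have both: "has_factor k (bip_col m) b {0..<n} ((lam - \<epsilon>) * n)" for b
    using has_factor_mono[OF m(2)] has_factor_mono[OF m(3)] kn
    by (cases b) (auto simp: algebra_simps)
  \<comment> \<open>Large enough for both size conditions of \<open>balanced_set\<close>, and a
    multiple of \<open>k\<close> so that deleting an \<open>M\<close>-clique preserves
    divisibility.\<close>
  define M where "M = k * (n * 2 ^ (2 * n) + 2 * n + 1)"
  have "1 * (n * 2 ^ (2 * n) + 2 * n + 1) \<le> M"
    unfolding M_def using k by (intro mult_right_mono) auto
  then have M: "n * 2 ^ (2 * n) < M" "2 * n \<le> M" by auto
  have Mk: "k dvd M" by (simp add: M_def)
  obtain C where C: "C \<ge> 0" "\<And>(c :: 'a set \<Rightarrow> bool) b W. finite W \<Longrightarrow> k dvd card W \<Longrightarrow>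
      \<nexists>A. A \<subseteq> W \<and> card A = M \<and> mono_clique c (\<not> b) A \<Longrightarrow> has_factor k c b W (lam * card W - C)"
    using mono_tiling[OF lam k, of M] by blast
  \<comment> \<open>\<open>C\<close> pays for the tiling and \<open>\<bar>lam\<bar> * M\<close> for
    one deleted clique.\<close>
  define D where "D = C + \<bar>lam\<bar> * M"
  have "\<exists>b. has_factor k c b U ((lam - \<epsilon>) * card U - D)" if "finite U" "k dvd card U"
    for c :: "'a set \<Rightarrow> bool" and U
    using that
  proof (induction "card U" arbitrary: U rule: less_induct)
    case less
    show ?case
    proof (cases "\<exists>S\<subseteq>U. card S = n \<and> (\<forall>b. has_factor k c b S ((lam - \<epsilon>) * n))")
      case True
      then obtain S where S: "S \<subseteq> U" "card S = n" "\<And>b. has_factor k c b S ((lam - \<epsilon>) * n)"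
        by blast
      have fin: "finite S" "finite (U - S)"
        using S less.prems finite_subset by auto
      have le: "n \<le> card U" using S less.prems(1) card_mono by blast
      have card: "card (U - S) = card U - n"
        using S fin by (simp add: card_Diff_subset)
      \<comment> \<open>The colour is dictated by \<open>U - S\<close>; being balanced,
        \<open>S\<close> can follow either choice.\<close>
      obtain b where "has_factor k c b (U - S) ((lam - \<epsilon>) * card (U - S) - D)"
        using less.hyps[of "U - S"] less.prems le card fin n by auto
      from has_factor_Un[OF S(3) this fin]
      have "has_factor k c b (S \<union> (U - S)) ((lam - \<epsilon>) * n + ((lam - \<epsilon>) * card (U - S) - D))"
        by auto
      then show ?thesis
        using S le by (intro exI[of _ b]) (simp add: card Un_absorb1 of_nat_diff algebra_simps)
    next
      case no_balanced: False
      have eps: "(lam - \<epsilon>) * card U \<le> lam * card U"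
        using \<epsilon> by (intro mult_right_mono) auto
      show ?thesis
      proof (cases "\<exists>A\<subseteq>U. card A = M \<and> mono_clique c True A")
        \<comment> \<open>Without a red \<open>M\<close>-clique, blue tiles all of \<open>U\<close>
          and nothing is deleted.\<close>
        case False
        then have "has_factor k c False U (lam * card U - C)"
          using less.prems by (intro C(2)) auto
        then show ?thesis
          using has_factor_mono eps unfolding D_def
          by (metis abs_ge_zero add_increasing2 diff_mono mult_nonneg_nonneg of_nat_0_le_iff order_refl)
      next
        case True
        then obtain A where A: "A \<subseteq> U" "card A = M" "mono_clique c True A" by blast
        have fin: "finite A" "finite (U - A)"
          using A less.prems finite_subset by auto
        have le: "M \<le> card U" using A less.prems(1) card_mono by blast
        have card: "card (U - A) = card U - M"
          using A fin by (simp add: card_Diff_subset)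
        \<comment> \<open>A blue \<open>M\<close>-clique disjoint from the red \<open>A\<close>
          would produce a balanced set inside \<open>U\<close>.\<close>
        have "\<nexists>B. B \<subseteq> U - A \<and> card B = M \<and> mono_clique c (\<not> True) B"
        proof
          assume "\<exists>B. B \<subseteq> U - A \<and> card B = M \<and> mono_clique c (\<not> True) B"
          then obtain B where B: "B \<subseteq> U - A" "card B = M" "mono_clique c False B" by auto
          have "\<exists>S\<subseteq>A \<union> B. card S = n \<and> (\<forall>b. has_factor k c b S ((lam - \<epsilon>) * n))"
            using A B M fin finite_subset[OF B(1)]
            by (intro balanced_set[OF m(1) both]) auto
          then show False using no_balanced A(1) B(1) by blast
        qed
        then have "has_factor k c True (U - A) (lam * card (U - A) - C)"
          using less.prems fin card Mk by (intro C(2)) auto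
        \<comment> \<open>The edges inside \<open>A\<close> are counted as zero; its bounded size
          lets \<open>D\<close> absorb the loss.\<close>
        moreover have "has_factor k c True A 0"
          using A fin k Mk by (intro has_factor_trivial) auto
        ultimately have "has_factor k c True (A \<union> (U - A)) (0 + (lam * card (U - A) - C))"
          using fin by (intro has_factor_Un) auto
        then have "has_factor k c True U (lam * card U - lam * M - C)"
          using A le by (simp add: card Un_absorb1 of_nat_diff algebra_simps)
        moreover have "lam * M \<le> \<bar>lam\<bar> * M"
          by (intro mult_right_mono) auto
        ultimately have "has_factor k c True U ((lam - \<epsilon>) * card U - D)"
          using eps unfolding D_def by (elim has_factor_mono) linarith
        then show ?thesis by blast
      qed
    qed
  qed
  moreover have "D \<ge> 0" using C(1) by (simp add: D_def)
  ultimately show ?thesis by blast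
qed

theorem theorem1p4:
  fixes k :: nat
  assumes "k \<ge> 2"
  shows "\<forall>\<delta>>0. \<exists>n0::nat. \<forall>n\<ge>n0. k dvd n \<longrightarrow>
           (\<forall>c :: nat set \<Rightarrow> bool. \<exists>F. is_Kk_factor k n F \<and>
              (\<exists>b. real (factor_edges_col c F b) \<ge> (lambda_k k - \<delta>) * real n))"
proof (intro allI impI)
  fix \<delta> :: real assume \<delta>: "\<delta> > 0"
  have k: "k > 0" using assms by simp
  \<comment> \<open>Zero is admissible, so the set is nonempty and \<open>less_cSupE\<close> gives
    an admissible \<open>lam\<close> close to the supremum.\<close>
  have "has_factor k (bip_col m) b {0..<n} (0 * real n)" if "k dvd n" for n m b
    using has_factor_trivial[of "{0..<n}" k] k that by simp
  then have "bip_bound k 0"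
    unfolding bip_bound_def by blast
  then have "{lam. bip_bound k lam} \<noteq> {}" by blast
  moreover have "lambda_k k - \<delta> / 3 < Sup {lam. bip_bound k lam}"
    using \<delta> by (simp add: lambda_k_eq)
  ultimately obtain lam where lam: "bip_bound k lam" "lambda_k k - \<delta> / 3 < lam"
    using less_cSupE by (metis mem_Collect_eq)
  obtain C where C: "C \<ge> 0" "\<And>(c :: nat set \<Rightarrow> bool) U. finite U \<Longrightarrow> k dvd card U \<Longrightarrow>
      \<exists>b. has_factor k c b U ((lam - \<delta> / 3) * card U - C)"
    using factor_bound[OF lam(1) k divide_pos_pos[OF \<delta> zero_less_numeral]] by blast
  show "\<exists>n0. \<forall>n\<ge>n0. k dvd n \<longrightarrow> (\<forall>c. \<exists>F. is_Kk_factor k n F \<and>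
          (\<exists>b. real (factor_edges_col c F b) \<ge> (lambda_k k - \<delta>) * real n))"
  \<comment> \<open>The error \<open>\<delta>\<close> is split in three: \<open>lam\<close> against
    \<open>lambda_k k\<close>, the loss in \<open>factor_bound\<close>, and the constant
    \<open>C\<close>, which is at most \<open>\<delta> / 3 * n\<close> from this threshold
    on.\<close>
  proof (intro exI[of _ "nat \<lceil>3 * C / \<delta>\<rceil>"] allI impI)
    fix n :: nat and c :: "nat set \<Rightarrow> bool"
    assume n: "nat \<lceil>3 * C / \<delta>\<rceil> \<le> n" "k dvd n"
    have "3 * C / \<delta> \<le> n" using n(1) by linarith
    then have "C \<le> \<delta> / 3 * n" using \<delta> by (simp add: field_simps)
    moreover have "(lambda_k k - \<delta> / 3) * n \<le> lam * n"
      using lam(2) by (intro mult_right_mono) auto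
    ultimately have le: "(lambda_k k - \<delta>) * n \<le> (lam - \<delta> / 3) * n - C"
      by (simp add: algebra_simps)
    obtain b where "has_factor k c b {0..<n} ((lam - \<delta> / 3) * n - C)"
      using C(2)[of "{0..<n}" c] n(2) by auto
    from has_factor_mono[OF this le]
    show "\<exists>F. is_Kk_factor k n F \<and>
        (\<exists>b. real (factor_edges_col c F b) \<ge> (lambda_k k - \<delta>) * real n)"
      unfolding has_factor_def is_Kk_factor_iff factor_edges_col_eq by blast
  qed
qed

end
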